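(* Let $1\le s < d/2$. Assume that the MLR property holds. Then $$\inf_{\tilde{\eta}} \sup_{|\eta|_{0} = s} \mathbf{E}_{\eta} |\tilde{\eta} - \eta| \geq (1-e^{-1})\,s\,F_{1}\Big( F_{0}^{-1}\big(1-\tfrac{1}{\lfloor d/s\rfloor-1}\big)\Big),$$ where $F_0,F_1$ are the cumulative distribution functions corresponding to $f_0,f_1$, and $F_{0}^{-1}(t)=\min\{v: F_0(v)=t\}$ for $t\in(0,1)$. (It is assumed that the quantile appearing here is well defined, i.e. that its argument lies in $(0,1)$ and the minimum exists.)
   Context: Pivotal selection problem: $d>2$ and $1\le s<d$ are integers; $P_0\neq P_1$ are probability measures with densities $f_0,f_1$ with respect to a common dominating measure $\mu$. For $\eta\in\{0,1\}^d$, under $\mathbf{P}_\eta$ the observations $X_1,\dots,X_d$ are independent, with $X_j\sim P_1$ if $\eta_j=1$ and $X_j\sim P_0$ if $\eta_j=0$; $\mathbf{E}_\eta$ is the corresponding expectation. A selector is any measurable function $\tilde\eta=\tilde\eta(X_1,\dots,X_d,\zeta)$ with values in $\{0,1\}^d$, where $\zeta$ is a randomization variable independent of $(X_1,\dots,X_d)$; $\inf_{\tilde\eta}$ is over all selectors. $|\tilde\eta-\eta|=\sum_{j=1}^d\mathbf{1}(\tilde\eta_j\ne\eta_j)$; $|\eta|_0$ is the number of non-zero components of $\eta$; $\sup_{|\eta|_0=s}$ is over $\eta\in\{0,1\}^d$ with $|\eta|_0=s$. MLR property: the observations take values in a subset of $\mathbb{R}$, the densities $f_0$ and $f_1$ have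 the same support, and $f_1/f_0$ is a (strictly) increasing function on the support of the densities. *)

theory Defs
  imports "HOL-Probability.Probability"
begin

definition binary_vectors :: "nat \<Rightarrow> (nat \<Rightarrow> nat) set" where
  "binary_vectors d = {1..d} \<rightarrow>\<^sub>E {0, 1}"

definition nonzero_count :: "nat \<Rightarrow> (nat \<Rightarrow> nat) \<Rightarrow> nat" where
  "nonzero_count d \<eta> = card {j \<in> {1..d}. \<eta> j \<noteq> 0}"

definition sparse_vectors :: "nat \<Rightarrow> nat \<Rightarrow> (nat \<Rightarrow> nat) set" where
  "sparse_vectors d s = {\<eta> \<in> binary_vectors d. nonzero_count d \<eta> = s}"

definition hamming_loss :: "nat \<Rightarrow> (nat \<Rightarrow> nat) \<Rightarrow> (nat \<Rightarrow> nat) \<Rightarrow> real" where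
  "hamming_loss d \<eta>' \<eta> = (\<Sum>j = 1..d. of_bool (\<eta>' j \<noteq> \<eta> j))"

definition observation_law ::
  "nat \<Rightarrow> 'a measure \<Rightarrow> 'a measure \<Rightarrow> (nat \<Rightarrow> nat) \<Rightarrow> (nat \<Rightarrow> 'a) measure" where
  "observation_law d P\<^sub>0 P\<^sub>1 \<eta> = PiM {1..d} (\<lambda>j. if \<eta> j = 1 then P\<^sub>1 else P\<^sub>0)"

text \<open>
  A randomized selector is a pair of the law \<open>Q\<close> of the randomization variable and a measurable
  map of the observations and that variable. Only the measurable structure of the observation
  space \<open>M\<close> is used. The value space of the randomization variable is a type variable, left free
  in theorems so that they cover every choice of it.
\<close>

definition selectors ::
  "nat \<Rightarrow> 'a measure \<Rightarrow> ('z measure \<times> ((nat \<Rightarrow> 'a) \<times> 'z \<Rightarrow> (nat \<Rightarrow> nat))) set" where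
  "selectors d M = {(Q, h). prob_space Q \<and>
     h \<in> PiM {1..d} (\<lambda>_. M) \<Otimes>\<^sub>M Q \<rightarrow>\<^sub>M count_space (binary_vectors d)}"

text \<open>
  The product with \<open>Q\<close> expresses that the randomization variable is independent of the
  observations and that its law does not depend on \<open>\<eta>\<close>.
\<close>

definition selector_risk ::
  "nat \<Rightarrow> 'a measure \<Rightarrow> 'a measure \<Rightarrow>
   'z measure \<times> ((nat \<Rightarrow> 'a) \<times> 'z \<Rightarrow> (nat \<Rightarrow> nat)) \<Rightarrow> (nat \<Rightarrow> nat) \<Rightarrow> real" where
  "selector_risk d P\<^sub>0 P\<^sub>1 sel \<eta> = (case sel of (Q, h) \<Rightarrow>
     \<integral>y. hamming_loss d (h y) \<eta> \<partial>(observation_law d P\<^sub>0 P\<^sub>1 \<eta> \<Otimes>\<^sub>M Q))"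

text \<open>
  The support of a density is the set where it does not vanish, so that the ratio is a genuine
  quotient on it.
\<close>

definition mlr_property :: "(real \<Rightarrow> real) \<Rightarrow> (real \<Rightarrow> real) \<Rightarrow> bool" where
  "mlr_property f\<^sub>0 f\<^sub>1 \<longleftrightarrow>
     {x. f\<^sub>0 x \<noteq> 0} = {x. f\<^sub>1 x \<noteq> 0} \<and> strict_mono_on {x. f\<^sub>0 x \<noteq> 0} (\<lambda>x. f\<^sub>1 x / f\<^sub>0 x)"

definition is_quantile :: "real measure \<Rightarrow> real \<Rightarrow> real \<Rightarrow> bool" where
  "is_quantile P t v \<longleftrightarrow> cdf P v = t \<and> (\<forall>w. cdf P w = t \<longrightarrow> v \<le> w)"

definition quantile :: "real measure \<Rightarrow> real \<Rightarrow> real" where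
  "quantile P t = (LEAST v. cdf P v = t)"

lemma quantile_eqI: "is_quantile P t v \<Longrightarrow> quantile P t = v"
  unfolding quantile_def is_quantile_def by (rule Least_equality) auto

text \<open>
  The next facts ensure that the minimax risk, an \<open>INF\<close> of \<open>SUP\<close>s over the reals, is a genuine
  infimum of suprema.
\<close>

lemma finite_sparse_vectors: "finite (sparse_vectors d s)"
  unfolding sparse_vectors_def binary_vectors_def by (simp add: finite_PiE)

lemma sparse_vectors_nonempty:
  assumes "s \<le> d"
  shows "sparse_vectors d s \<noteq> {}"
proof -
  define \<eta> :: "nat \<Rightarrow> nat" where "\<eta> = (\<lambda>j\<in>{1..d}. of_bool (j \<le> s))"
  have "{j \<in> {1..d}. \<eta> j \<noteq> 0} = {1..s}"
    using assms by (auto simp: \<eta>_def)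
  moreover have "\<eta> \<in> binary_vectors d"
    by (auto simp: \<eta>_def binary_vectors_def)
  ultimately have "\<eta> \<in> sparse_vectors d s"
    by (simp add: sparse_vectors_def nonzero_count_def)
  then show ?thesis by blast
qed

lemma selectors_nonempty: "(selectors d M :: ('z measure \<times> _) set) \<noteq> {}"
proof -
  let ?Q = "return (count_space UNIV) (undefined :: 'z)"
  have "prob_space ?Q"
    by (rule prob_space_return) simp
  moreover have "(\<lambda>_. \<lambda>j\<in>{1..d}. 0) \<in>
      PiM {1..d} (\<lambda>_. M) \<Otimes>\<^sub>M ?Q \<rightarrow>\<^sub>M count_space (binary_vectors d)"
    by (auto simp: binary_vectors_def)
  ultimately have "(?Q, \<lambda>_. \<lambda>j\<in>{1..d}. 0) \<in> selectors d M"
    by (simp add: selectors_def)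
  then show ?thesis by blast
qed

lemma selector_risk_nonneg: "0 \<le> selector_risk d P\<^sub>0 P\<^sub>1 sel \<eta>"
  unfolding selector_risk_def hamming_loss_def
  by (auto split: prod.split intro!: integral_nonneg_AE sum_nonneg)

lemma bdd_below_worst_case_risk:
  assumes "s \<le> d"
  shows "bdd_below ((\<lambda>sel. SUP \<eta>\<in>sparse_vectors d s. selector_risk d P\<^sub>0 P\<^sub>1 sel \<eta>) ` S)"
proof (rule bdd_belowI2)
  fix sel
  obtain \<eta> where \<eta>: "\<eta> \<in> sparse_vectors d s"
    using sparse_vectors_nonempty[OF assms] by blast
  show "0 \<le> (SUP \<eta>\<in>sparse_vectors d s. selector_risk d P\<^sub>0 P\<^sub>1 sel \<eta>)"
    by (rule cSUP_upper2[OF _ \<eta> selector_risk_nonneg])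
      (simp add: finite_sparse_vectors bdd_above_finite)
qed

lemma integrable_hamming_loss:
  assumes "(Q, h) \<in> selectors d M"
    and "prob_space P\<^sub>0" "prob_space P\<^sub>1" "sets P\<^sub>0 = sets M" "sets P\<^sub>1 = sets M"
  shows "integrable (observation_law d P\<^sub>0 P\<^sub>1 \<eta> \<Otimes>\<^sub>M Q) (\<lambda>y. hamming_loss d (h y) \<eta>)"
proof -
  let ?L = "observation_law d P\<^sub>0 P\<^sub>1 \<eta>"
  have Q: "prob_space Q" and h: "h \<in> PiM {1..d} (\<lambda>_. M) \<Otimes>\<^sub>M Q \<rightarrow>\<^sub>M count_space (binary_vectors d)"
    using assms(1) by (auto simp: selectors_def)
  have L: "prob_space ?L"
    unfolding observation_law_def by (rule prob_space_PiM) (use assms in auto)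
  interpret Q: prob_space Q by (rule Q)
  interpret L: prob_space ?L by (rule L)
  interpret pair_prob_space ?L Q ..
  have "sets ?L = sets (PiM {1..d} (\<lambda>_. M))"
    unfolding observation_law_def by (rule sets_PiM_cong) (use assms in auto)
  then have "sets (?L \<Otimes>\<^sub>M Q) = sets (PiM {1..d} (\<lambda>_. M) \<Otimes>\<^sub>M Q)"
    by (rule sets_pair_measure_cong) simp
  then have "h \<in> ?L \<Otimes>\<^sub>M Q \<rightarrow>\<^sub>M count_space (binary_vectors d)"
    using h measurable_cong_sets by blast
  then have "(\<lambda>y. hamming_loss d (h y) \<eta>) \<in> borel_measurable (?L \<Otimes>\<^sub>M Q)"
    by (rule measurable_compose) simp
  moreover have "norm (hamming_loss d (h y) \<eta>) \<le> real d" for y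
  proof -
    have "hamming_loss d (h y) \<eta> \<le> (\<Sum>j = 1..d. 1)"
      unfolding hamming_loss_def by (rule sum_mono) simp
    moreover have "0 \<le> hamming_loss d (h y) \<eta>"
      unfolding hamming_loss_def by (rule sum_nonneg) simp
    ultimately show ?thesis by simp
  qed
  ultimately show ?thesis
    by (intro P.integrable_const_bound[where B = "real d"]) auto
qed

end

theory Submission
  imports Defs
begin

text \<open>
  With \<open>m = \<lfloor>d/s\<rfloor>\<close>, split \<open>s * m\<close> of the coordinates into \<open>s\<close> blocks of size \<open>m\<close> and put one nonzero
  component uniformly at random into each block; the worst-case risk dominates the average risk.
  In each block the loss is at least the probability of not recovering the block exactly. Given
  the other blocks, the \<open>m\<close> candidate positions have likelihoods proportional to the values
  of \<open>f\<^sub>1/f\<^sub>0\<close>, so by monotonicity of this ratio any selector errs at least as often as the event that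
  the signal lies below the threshold \<open>v\<close> while some noise observation exceeds it. That event has
  probability \<open>F\<^sub>1(v) (1 - F\<^sub>0(v)\<^sup>m\<^sup>-\<^sup>1)\<close>, and the choice \<open>F\<^sub>0(v) = 1 - 1/(m-1)\<close> gives the factor
  \<open>1 - 1/e\<close>.
\<close>

section \<open>Likelihoods of product laws\<close>

text \<open>A measure on a finite product is determined by its values on boxes, and on a box the
  integral of a product of one-coordinate functions factorizes. The hypotheses range over all
  indices because the locale \<open>product_sigma_finite\<close> constrains the whole
  family.\<close>

lemma density_PiM:
  fixes f :: "'i \<Rightarrow> 'a \<Rightarrow> ennreal"
  assumes "finite I"
    and "\<And>i. prob_space (N i)"
    and "\<And>i. f i \<in> borel_measurable (N i)"
    and "\<And>i. prob_space (density (N i) (f i))"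
  shows "density (PiM I N) (\<lambda>x. \<Prod>i\<in>I. f i (x i)) = PiM I (\<lambda>i. density (N i) (f i))"
proof -
  interpret N: product_sigma_finite N
    by (simp add: product_sigma_finite_def assms(2) prob_space_imp_sigma_finite)
  interpret D: product_sigma_finite "\<lambda>i. density (N i) (f i)"
    by (simp add: product_sigma_finite_def assms(4) prob_space_imp_sigma_finite)
  note [measurable] = assms(3)
  show ?thesis
  proof (rule D.PiM_eqI[OF assms(1)])
    show "sets (density (PiM I N) (\<lambda>x. \<Prod>i\<in>I. f i (x i)))
        = sets (PiM I (\<lambda>i. density (N i) (f i)))"
      unfolding sets_density by (rule sets_PiM_cong) auto
  next
    fix A assume "\<And>i. i \<in> I \<Longrightarrow> A i \<in> sets (density (N i) (f i))"
    then have A[measurable]: "\<And>i. i \<in> I \<Longrightarrow> A i \<in> sets (N i)" by simp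
    have "emeasure (density (PiM I N) (\<lambda>x. \<Prod>i\<in>I. f i (x i))) (Pi\<^sub>E I A)
        = (\<integral>\<^sup>+x. (\<Prod>i\<in>I. f i (x i)) * indicator (Pi\<^sub>E I A) x \<partial>PiM I N)"
      using A assms(1) by (intro emeasure_density) (auto intro!: sets_PiM_I_finite)
    also have "\<dots> = (\<integral>\<^sup>+x. (\<Prod>i\<in>I. f i (x i) * indicator (A i) (x i)) \<partial>PiM I N)"
      by (intro nn_integral_cong)
        (auto simp: prod.distrib space_PiM indicator_def PiE_def assms(1) Pi_iff)
    also have "\<dots> = (\<Prod>i\<in>I. \<integral>\<^sup>+x. f i x * indicator (A i) x \<partial>N i)"
      using A assms(1)
      by (intro N.product_nn_integral_prod[of I "\<lambda>i x. f i x * indicator (A i) x"]) auto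
    also have "\<dots> = (\<Prod>i\<in>I. emeasure (density (N i) (f i)) (A i))"
      using A by (intro prod.cong) (simp_all add: emeasure_density)
    finally show "emeasure (density (PiM I N) (\<lambda>x. \<Prod>i\<in>I. f i (x i))) (Pi\<^sub>E I A)
        = (\<Prod>i\<in>I. emeasure (density (N i) (f i)) (A i))" .
  qed
qed

text \<open>With the pure-noise law as common dominating measure, a noise coordinate contributes the
  factor 1 and a signal coordinate the factor \<open>r\<close>. Probabilities under different
  \<open>\<eta>\<close> thereby become integrals against one measure and can be compared
  pointwise.\<close>

lemma observation_law_density:
  fixes r :: "'a \<Rightarrow> ennreal"
  assumes "prob_space P\<^sub>0" "prob_space P\<^sub>1"
    and [measurable]: "r \<in> borel_measurable P\<^sub>0"
    and P1: "P\<^sub>1 = density P\<^sub>0 r"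
  shows "observation_law d P\<^sub>0 P\<^sub>1 \<eta>
    = density (PiM {1..d} (\<lambda>_. P\<^sub>0)) (\<lambda>x. \<Prod>j\<in>{j\<in>{1..d}. \<eta> j = 1}. r (x j))"
proof -
  have eq: "(if \<eta> j = 1 then P\<^sub>1 else P\<^sub>0) = density P\<^sub>0 (\<lambda>x. if \<eta> j = 1 then r x else 1)" for j
    by (simp add: P1 density_1)
  have "prob_space (density P\<^sub>0 (\<lambda>x. if \<eta> j = 1 then r x else 1))" for j
    unfolding eq[symmetric] using assms by simp
  then have "observation_law d P\<^sub>0 P\<^sub>1 \<eta>
    = density (PiM {1..d} (\<lambda>_. P\<^sub>0)) (\<lambda>x. \<Prod>j\<in>{1..d}. if \<eta> j = 1 then r (x j) else 1)"
    unfolding observation_law_def eq using assms(1)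
    by (subst density_PiM[symmetric]) auto
  then show ?thesis
    unfolding prod.inter_filter[OF finite_atLeastAtMost] .
qed

section \<open>Weights and probabilities of the threshold event\<close>

text \<open>
  An exchange argument: at most one index is missing from \<open>D\<close>; if it lies below the threshold, its
  weight is paid for by an index above the threshold.
\<close>

lemma sum_below_threshold_le:
  fixes w :: "'i \<Rightarrow> ennreal" and x :: "'i \<Rightarrow> real"
  assumes "finite J" "D \<subseteq> J"
    and miss: "\<And>k l. k \<in> J - D \<Longrightarrow> l \<in> J - D \<Longrightarrow> k = l"
    and mono: "\<And>k l. k \<in> J \<Longrightarrow> l \<in> J \<Longrightarrow> x k \<le> v \<Longrightarrow> v < x l \<Longrightarrow> w k \<le> w l"
    and l: "l \<in> J" "v < x l"
  shows "(\<Sum>k\<in>{k\<in>J. x k \<le> v}. w k) \<le> (\<Sum>k\<in>D. w k)"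
proof (cases "{k\<in>J. x k \<le> v} \<subseteq> D")
  case True
  then show ?thesis
    using assms by (intro sum_mono2) (auto intro: finite_subset)
next
  case False
  then obtain k where k: "k \<in> J" "x k \<le> v" "k \<notin> D" by auto
  let ?B = "{i\<in>J. x i \<le> v}"
  have "l \<noteq> k" using k l by auto
  then have "l \<in> D" using miss[of k l] k l by auto
  have sub: "insert l (?B - {k}) \<subseteq> D"
    using miss k \<open>l \<in> D\<close> by blast
  have fin: "finite ?B" "finite D" using assms by (auto intro: finite_subset)
  have "sum w ?B = w k + sum w (?B - {k})"
    using k fin by (intro sum.remove) auto
  also have "\<dots> \<le> w l + sum w (?B - {k})"
    using mono[of k l] k l by (intro add_right_mono) auto
  also have "\<dots> = sum w (insert l (?B - {k}))"
    using l fin by (subst sum.insert) auto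
  also have "\<dots> \<le> sum w D"
    using sub fin by (intro sum_mono2) auto
  finally show ?thesis .
qed

text \<open>As \<open>k \<in> J\<close>, the event is the box \<open>x k \<le> v\<close> minus the
  smaller box where all coordinates in \<open>J\<close> are at most \<open>v\<close>. By
  independence the latter has one factor \<open>cdf P\<^sub>1 v\<close> from position
  \<open>k\<close> and \<open>card J - 1\<close> factors \<open>cdf P\<^sub>0 v\<close> from the
  noise positions.\<close>

lemma prob_below_not_all_below:
  fixes P\<^sub>0 P\<^sub>1 :: "real measure"
  assumes "prob_space P\<^sub>0" "prob_space P\<^sub>1" "sets P\<^sub>0 = sets borel" "sets P\<^sub>1 = sets borel"
    and J: "J \<subseteq> {1..d}" "\<And>j. j \<in> J \<Longrightarrow> \<zeta> j = 0" and k: "k \<in> J"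
  shows "measure (observation_law d P\<^sub>0 P\<^sub>1 (\<zeta>(k := 1)))
      {x \<in> space (observation_law d P\<^sub>0 P\<^sub>1 (\<zeta>(k := 1))). x k \<le> v \<and> (\<exists>j\<in>J. v < x j)}
    = cdf P\<^sub>1 v * (1 - cdf P\<^sub>0 v ^ (card J - 1))"
proof -
  define N where "N = (\<lambda>j. if (\<zeta>(k := 1)) j = 1 then P\<^sub>1 else P\<^sub>0)"
  define L where "L = PiM {1..d} N"
  have N: "prob_space (N j)" "sets (N j) = sets borel" "space (N j) = UNIV" for j
    using assms sets_eq_imp_space_eq[of "N j" borel] by (auto simp: N_def)
  interpret product_prob_space N "{1..d}"
    using N by (simp add: product_prob_space_def product_sigma_finite_def
        product_prob_space_axioms_def prob_space_imp_sigma_finite)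
  have fin: "finite J" using J(1) finite_subset by blast
  have box: "measure L {x\<in>space L. \<forall>j\<in>K. x j \<le> v} = (\<Prod>j\<in>K. cdf (N j) v)"
    if "K \<subseteq> J" for K
  proof -
    have "K \<subseteq> {1..d}" using that J by blast
    moreover have "finite K" using that fin finite_subset by blast
    moreover have "{x\<in>space L. \<forall>j\<in>K. x j \<le> v} = prod_emb {1..d} N K (Pi\<^sub>E K (\<lambda>_. {..v}))"
      by (auto simp: L_def prod_emb_def space_PiM PiE_def Pi_iff)
    ultimately show ?thesis
      using measure_PiM_emb[of K "\<lambda>_. {..v}"] N by (simp add: L_def cdf_def)
  qed
  have sets: "{x\<in>space L. \<forall>j\<in>K. x j \<le> v} \<in> sets L" if "K \<subseteq> J" for K
  proof -
    have "finite K" using that fin finite_subset by blast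
    have "(\<lambda>x. x j) \<in> L \<rightarrow>\<^sub>M borel" if "j \<in> K" for j
      using measurable_component_singleton[of j "{1..d}" N] that J \<open>K \<subseteq> J\<close> N(2)[of j]
      by (auto simp: L_def cong: measurable_cong_sets)
    then show ?thesis
      using \<open>finite K\<close> by (intro sets.sets_Collect_finite_All) auto
  qed
  have "{x\<in>space L. x k \<le> v \<and> (\<exists>j\<in>J. v < x j)}
      = {x\<in>space L. \<forall>j\<in>{k}. x j \<le> v} - {x\<in>space L. \<forall>j\<in>J. x j \<le> v}"
    by (auto simp: not_le)
  then have "measure L {x\<in>space L. x k \<le> v \<and> (\<exists>j\<in>J. v < x j)}
      = measure L ({x\<in>space L. \<forall>j\<in>{k}. x j \<le> v} - {x\<in>space L. \<forall>j\<in>J. x j \<le> v})"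
    by (rule arg_cong)
  also have "\<dots> = measure L {x\<in>space L. \<forall>j\<in>{k}. x j \<le> v}
      - measure L {x\<in>space L. \<forall>j\<in>J. x j \<le> v}"
    using k sets[of "{k}"] sets[of J]
    by (intro P.finite_measure_Diff[folded L_def]) auto
  also have "\<dots> = cdf (N k) v - (\<Prod>j\<in>J. cdf (N j) v)"
    using k box[of "{k}"] box[of J] by simp
  also have "(\<Prod>j\<in>J. cdf (N j) v) = cdf P\<^sub>1 v * (\<Prod>j\<in>J - {k}. cdf (N j) v)"
    using k fin by (subst prod.remove[of J k]) (auto simp: N_def)
  also have "(\<Prod>j\<in>J - {k}. cdf (N j) v) = (\<Prod>j\<in>J - {k}. cdf P\<^sub>0 v)"
    using J by (intro prod.cong) (auto simp: N_def)
  also have "\<dots> = cdf P\<^sub>0 v ^ (card J - 1)"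
    using k fin by simp
  finally show ?thesis
    by (simp add: L_def N_def observation_law_def algebra_simps)
qed

section \<open>Error bound for a single block\<close>

lemma selector_measurable:
  assumes "(Q, h) \<in> selectors d M"
    and "sets L = sets (PiM {1..d} (\<lambda>_. M))"
  shows "h \<in> L \<Otimes>\<^sub>M Q \<rightarrow>\<^sub>M count_space (binary_vectors d)"
  using assms(1) measurable_cong_sets[OF sets_pair_measure_cong[OF assms(2) refl] refl]
  by (auto simp only: selectors_def mem_Collect_eq prod.case)

lemma sets_observation_law:
  assumes "sets P\<^sub>0 = sets M" "sets P\<^sub>1 = sets M"
  shows "sets (observation_law d P\<^sub>0 P\<^sub>1 \<eta>) = sets (PiM {1..d} (\<lambda>_. M))"
  unfolding observation_law_def by (rule sets_PiM_cong) (use assms in auto)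

lemma prob_space_observation_law:
  assumes "prob_space P\<^sub>0" "prob_space P\<^sub>1"
  shows "prob_space (observation_law d P\<^sub>0 P\<^sub>1 \<eta>)"
  unfolding observation_law_def by (rule prob_space_PiM) (use assms in auto)

text \<open>Here \<open>\<zeta>\<close> is a signal vanishing on the block \<open>J\<close>, and
  \<open>r\<close> is the likelihood ratio. The left side sums, over the positions \<open>k\<close>
  of the additional signal, the probability that it is at most \<open>v\<close> while some
  coordinate of the block exceeds \<open>v\<close>. Summing over \<open>k\<close> is essential: a
  selector can be perfect for a single \<open>k\<close>.\<close>

lemma block_error_lower_bound:
  fixes P\<^sub>0 P\<^sub>1 M :: "real measure" and r :: "real \<Rightarrow> ennreal"
  assumes P: "prob_space P\<^sub>0" "prob_space P\<^sub>1"
    and M: "sets M = sets borel" "sets P\<^sub>0 = sets M" "sets P\<^sub>1 = sets M"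
    and r[measurable]: "r \<in> borel_measurable P\<^sub>0"
    and P1: "P\<^sub>1 = density P\<^sub>0 r"
    and S: "AE x in P\<^sub>0. x \<in> S"
    and mono: "mono_on S r"
    and sel: "(Q, h) \<in> selectors d M"
    and J: "J \<subseteq> {1..d}" "\<And>j. j \<in> J \<Longrightarrow> \<zeta> j = 0"
  shows "real (card J) * (cdf P\<^sub>1 v * (1 - cdf P\<^sub>0 v ^ (card J - 1)))
    \<le> (\<Sum>k\<in>J. measure (observation_law d P\<^sub>0 P\<^sub>1 (\<zeta>(k := 1)) \<Otimes>\<^sub>M Q)
        {y \<in> space (observation_law d P\<^sub>0 P\<^sub>1 (\<zeta>(k := 1)) \<Otimes>\<^sub>M Q).
          \<exists>j\<in>J. h y j \<noteq> (\<zeta>(k := 1)) j})"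
proof -
  define N where "N = PiM {1..d} (\<lambda>_. P\<^sub>0)"
  define R where "R = N \<Otimes>\<^sub>M Q"
  define L where "L = (\<lambda>k. observation_law d P\<^sub>0 P\<^sub>1 (\<zeta>(k := 1)))"
  define w where "w = (\<lambda>k x. \<Prod>j\<in>{j\<in>{1..d}. (\<zeta>(k := 1)) j = 1}. r (x j))"
  \<comment> \<open>\<open>U\<close> is the likelihood of the nonzero components outside the block.
    It is common to all candidate positions, so comparing the weights \<open>w k\<close> reduces to
    comparing the values \<open>r (x k)\<close>.\<close>
  define U where "U = (\<lambda>x. \<Prod>j\<in>{j\<in>{1..d}. \<zeta> j = 1}. r (x j))"
  \<comment> \<open>\<open>D k\<close> is the event that the selector errs on the block when the
    signal sits at \<open>k\<close>; \<open>E k\<close> below is the threshold event that it is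
    compared with.\<close>
  define D where "D = (\<lambda>k. {y\<in>space R. \<exists>j\<in>J. h y j \<noteq> (\<zeta>(k := 1)) j})"
  define E where "E = (\<lambda>k. {y\<in>space R. fst y k \<le> v \<and> (\<exists>j\<in>J. v < fst y j)})"
  define c where "c = cdf P\<^sub>1 v * (1 - cdf P\<^sub>0 v ^ (card J - 1))"
  have Q: "prob_space Q" using sel by (simp add: selectors_def)
  interpret Q: prob_space Q by (rule Q)
  interpret P0: product_prob_space "\<lambda>_. P\<^sub>0" "{1..d}"
    using P by (simp add: product_prob_space_def product_sigma_finite_def
        product_prob_space_axioms_def prob_space_imp_sigma_finite)
  have L: "prob_space (L k)" "prob_space (L k \<Otimes>\<^sub>M Q)" for k
  proof -
    show *: "prob_space (L k)"
      unfolding L_def by (rule prob_space_observation_law) fact+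
    interpret L: prob_space "L k" by (rule *)
    interpret pair_prob_space "L k" Q ..
    show "prob_space (L k \<Otimes>\<^sub>M Q)" by (rule P.prob_space_axioms)
  qed
  have em: "emeasure (L k \<Otimes>\<^sub>M Q) X = ennreal (measure (L k \<Otimes>\<^sub>M Q) X)" for k X
    by (rule finite_measure.emeasure_eq_measure[OF prob_space.finite_measure[OF L(2)]])
  have fin: "finite J" using J(1) finite_subset by blast
  have comp[measurable]: "(\<lambda>x. x j) \<in> N \<rightarrow>\<^sub>M P\<^sub>0" if "j \<in> {1..d}" for j
    unfolding N_def by (rule measurable_component_singleton[OF that])
  have w_eq: "w k x = r (x k) * U x" if "k \<in> J" for k x
  proof -
    have "{j\<in>{1..d}. (\<zeta>(k := 1)) j = 1} = insert k {j\<in>{1..d}. \<zeta> j = 1}"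
      using that J by auto
    then show ?thesis using that J(2)[of k] by (simp add: w_def U_def)
  qed
  have w[measurable]: "w k \<in> borel_measurable N" for k
    unfolding w_def by (intro borel_measurable_prod_ennreal) (auto intro!: measurable_compose[OF comp r])
  have wR[measurable]: "(\<lambda>y. w k (fst y)) \<in> borel_measurable R" for k
    unfolding R_def by measurable
  \<comment> \<open>All laws \<open>L k \<Otimes>\<^sub>M Q\<close> get densities with respect to
    the single measure \<open>R\<close>; randomization is just a further coordinate, with density
    1.\<close>
  have LR: "L k \<Otimes>\<^sub>M Q = density R (\<lambda>y. w k (fst y))" for k
  proof -
    have "L k \<Otimes>\<^sub>M Q = density N (w k) \<Otimes>\<^sub>M density Q (\<lambda>_. 1)"
      using observation_law_density[OF P r P1, of d "\<zeta>(k := 1)"]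
      by (simp add: L_def N_def w_def density_1)
    also have "\<dots> = density R (\<lambda>(x, z). w k x * 1)"
      unfolding R_def using Q.sigma_finite_measure_axioms
      by (intro pair_measure_density) (auto simp: density_1)
    finally show ?thesis by (simp add: case_prod_unfold)
  qed
  have h: "h \<in> R \<rightarrow>\<^sub>M count_space (binary_vectors d)"
    unfolding R_def N_def by (rule selector_measurable[OF sel]) (rule sets_PiM_cong, auto simp: M)
  have D[measurable]: "D k \<in> sets R" for k
  proof -
    have "D k = h -` {a \<in> binary_vectors d. \<exists>j\<in>J. a j \<noteq> (\<zeta>(k := 1)) j} \<inter> space R"
      using measurable_space[OF h] by (auto simp: D_def)
    then show ?thesis
      using measurable_sets[OF h] by (metis (no_types, lifting) sets_count_space Pow_iff mem_Collect_eq subsetI)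
  qed
  have [measurable]: "(\<lambda>x. x j) \<in> borel_measurable N" if "j \<in> J" for j
    using comp[of j] that J M by (auto cong: measurable_cong_sets)
  define A where "A = (\<lambda>k. {x\<in>space N. x k \<le> v \<and> (\<exists>j\<in>J. v < x j)})"
  have A: "A k \<in> sets N" if "k \<in> J" for k
    unfolding A_def using fin that
    by (intro sets.sets_Collect_conj sets.sets_Collect_finite_Ex) auto
  \<comment> \<open>The threshold event ignores the randomization, so its probability is that of
    \<open>A k\<close> under the observation law alone.\<close>
  have E_eq: "E k = A k \<times> space Q" for k
    by (auto simp: E_def A_def R_def space_pair_measure)
  have E[measurable]: "E k \<in> sets R" if "k \<in> J" for k
    using A[OF that] by (simp add: E_eq R_def)
  have space_L: "sets (L k) = sets N" "space (L k) = space N" for k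
  proof -
    show "sets (L k) = sets N"
      unfolding L_def N_def
      by (subst sets_observation_law[of _ P\<^sub>0]) (auto simp: M)
    then show "space (L k) = space N" by (rule sets_eq_imp_space_eq)
  qed
  have "measure (L k \<Otimes>\<^sub>M Q) (E k) = c" if "k \<in> J" for k
  proof -
    have "measure (L k \<Otimes>\<^sub>M Q) (E k) = measure (L k) (A k)"
      unfolding E_eq measure_def using A[OF that] space_L[of k]
      by (subst Q.emeasure_pair_measure_Times) (auto simp: Q.emeasure_space_1)
    also have "\<dots> = c"
      using prob_below_not_all_below[OF P _ _ J(1) _ that, where v = v and \<zeta> = \<zeta>] M J(2) space_L(2)[of k]
      by (simp add: A_def L_def c_def)
    finally show ?thesis .
  qed
  then have "ennreal (card J * c) = (\<Sum>k\<in>J. emeasure (L k \<Otimes>\<^sub>M Q) (E k))"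
    by (simp add: em ennreal_mult' ennreal_of_nat_eq_real_of_nat)
  also have "\<dots> = (\<Sum>k\<in>J. \<integral>\<^sup>+y. w k (fst y) * indicator (E k) y \<partial>R)"
    unfolding LR by (intro sum.cong refl emeasure_density) auto
  also have "\<dots> = (\<integral>\<^sup>+y. (\<Sum>k\<in>J. w k (fst y) * indicator (E k) y) \<partial>R)"
    by (subst nn_integral_sum) auto
  also have "\<dots> \<le> (\<integral>\<^sup>+y. (\<Sum>k\<in>J. w k (fst y) * indicator (D k) y) \<partial>R)"
  proof (rule nn_integral_mono_AE)
    \<comment> \<open>The ratio is monotone only on \<open>S\<close>, which has full
      \<open>P\<^sub>0\<close>-measure; finiteness of \<open>J\<close> lets all coordinates of the
      block lie in \<open>S\<close> simultaneously, almost surely.\<close>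
    have "AE x in N. \<forall>j\<in>J. x j \<in> S"
      unfolding N_def using J fin S by (intro AE_finite_allI P0.AE_component) auto
    then have "AE x in distr R N fst. \<forall>j\<in>J. x j \<in> S"
      unfolding R_def Q.distr_pair_fst .
    then have "AE y in R. \<forall>j\<in>J. fst y j \<in> S"
      by (rule AE_distrD[rotated]) (simp add: R_def)
    then show "AE y in R. (\<Sum>k\<in>J. w k (fst y) * indicator (E k) y)
        \<le> (\<Sum>k\<in>J. w k (fst y) * indicator (D k) y)"
    proof (rule AE_mp, intro AE_I2 impI)
      fix y assume y: "y \<in> space R" "\<forall>j\<in>J. fst y j \<in> S"
      have sum_ind: "(\<Sum>k\<in>J. w k (fst y) * indicator (F k) y) = (\<Sum>k\<in>{k\<in>J. y \<in> F k}. w k (fst y))"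
        for F
        unfolding sum.inter_filter[OF fin] by (intro sum.cong) (auto simp: indicator_def)
      show "(\<Sum>k\<in>J. w k (fst y) * indicator (E k) y) \<le> (\<Sum>k\<in>J. w k (fst y) * indicator (D k) y)"
      proof (cases "\<exists>l\<in>J. v < fst y l")
        case True
        then obtain l where l: "l \<in> J" "v < fst y l" by blast
        have "{k\<in>J. y \<in> E k} = {k\<in>J. fst y k \<le> v}"
          using True y by (auto simp: E_def)
        moreover have "(\<Sum>k\<in>{k\<in>J. fst y k \<le> v}. w k (fst y)) \<le> (\<Sum>k\<in>{k\<in>J. y \<in> D k}. w k (fst y))"
        proof (rule sum_below_threshold_le[where x = "fst y", OF fin _ _ _ l])
          \<comment> \<open>A single output \<open>h y\<close> can be correct on the block for at
            most one position: \<open>\<zeta>(k := 1)\<close> and \<open>\<zeta>(l := 1)\<close>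
            already differ at \<open>k\<close> when \<open>k \<noteq> l\<close>.\<close>
          fix k l assume kl: "k \<in> J - {k\<in>J. y \<in> D k}" "l \<in> J - {k\<in>J. y \<in> D k}"
          then have "(\<zeta>(k := 1)) k = (\<zeta>(l := 1)) k"
            using y by (auto simp: D_def)
          then show "k = l" using kl J(2)[of k] by (auto split: if_splits)
        next
          fix k l assume kl: "k \<in> J" "l \<in> J" "fst y k \<le> v" "v < fst y l"
          then have "r (fst y k) \<le> r (fst y l)"
            using y by (intro mono_onD[OF mono]) auto
          then show "w k (fst y) \<le> w l (fst y)"
            using kl by (simp add: w_eq mult_right_mono)
        qed auto
        ultimately show ?thesis by (simp add: sum_ind)
      next
        \<comment> \<open>No coordinate of the block exceeds \<open>v\<close>, so every
          \<open>E k\<close> fails and the left side is 0.\<close>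
        case False
        then show ?thesis by (auto simp: E_def sum_ind)
      qed
    qed
  qed
  also have "\<dots> = (\<Sum>k\<in>J. \<integral>\<^sup>+y. w k (fst y) * indicator (D k) y \<partial>R)"
    by (subst nn_integral_sum) auto
  also have "\<dots> = (\<Sum>k\<in>J. emeasure (L k \<Otimes>\<^sub>M Q) (D k))"
    unfolding LR by (intro sum.cong refl emeasure_density[symmetric]) auto
  also have "\<dots> = ennreal (\<Sum>k\<in>J. measure (L k \<Otimes>\<^sub>M Q) (D k))"
    by (simp add: em)
  finally have "card J * c \<le> (\<Sum>k\<in>J. measure (L k \<Otimes>\<^sub>M Q) (D k))"
    by (simp add: sum_nonneg)
  moreover have "space (L k \<Otimes>\<^sub>M Q) = space R" for k
    unfolding LR by simp
  ultimately show ?thesis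
    by (simp add: c_def L_def D_def)
qed

section \<open>From block errors to the worst-case risk\<close>

text \<open>The restriction makes the vector extensional, as membership in
  \<open>binary_vectors\<close> demands.\<close>

definition indicator_vector :: "nat \<Rightarrow> nat set \<Rightarrow> nat \<Rightarrow> nat" where
  "indicator_vector d A = (\<lambda>j\<in>{1..d}. of_bool (j \<in> A))"

lemma indicator_vector_apply: "j \<in> {1..d} \<Longrightarrow> indicator_vector d A j = of_bool (j \<in> A)"
  by (simp add: indicator_vector_def)

lemma indicator_vector_insert:
  "k \<in> {1..d} \<Longrightarrow> indicator_vector d (insert k A) = (indicator_vector d A)(k := 1)"
  by (auto simp: indicator_vector_def fun_eq_iff)

lemma indicator_vector_sparse:
  assumes "A \<subseteq> {1..d}"
  shows "indicator_vector d A \<in> sparse_vectors d (card A)"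
proof -
  have "{j\<in>{1..d}. indicator_vector d A j \<noteq> 0} = A"
    using assms by (auto simp: indicator_vector_def)
  moreover have "indicator_vector d A \<in> binary_vectors d"
    by (auto simp: indicator_vector_def binary_vectors_def)
  ultimately show ?thesis
    by (simp add: sparse_vectors_def nonzero_count_def)
qed

definition block_error ::
  "nat \<Rightarrow> 'a measure \<Rightarrow> 'a measure \<Rightarrow> 'z measure \<Rightarrow>
   ((nat \<Rightarrow> 'a) \<times> 'z \<Rightarrow> (nat \<Rightarrow> nat)) \<Rightarrow> nat set \<Rightarrow> (nat \<Rightarrow> nat) \<Rightarrow> real" where
  "block_error d P\<^sub>0 P\<^sub>1 Q h J \<eta> = measure (observation_law d P\<^sub>0 P\<^sub>1 \<eta> \<Otimes>\<^sub>M Q)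
     {y \<in> space (observation_law d P\<^sub>0 P\<^sub>1 \<eta> \<Otimes>\<^sub>M Q). \<exists>j\<in>J. h y j \<noteq> \<eta> j}"

text \<open>A wrongly recovered block contains at least one wrong coordinate, and disjointness
  prevents counting a coordinate twice.\<close>

lemma hamming_loss_ge_blocks:
  assumes "finite B" "\<And>b. b \<in> B \<Longrightarrow> J b \<subseteq> {1..d}" "disjoint_family_on J B"
  shows "(\<Sum>b\<in>B. of_bool (\<exists>j\<in>J b. a j \<noteq> \<eta> j)) \<le> hamming_loss d a \<eta>"
proof -
  have fin: "finite (J b)" if "b \<in> B" for b
    using assms(2)[OF that] finite_subset by blast
  have "(\<Sum>b\<in>B. of_bool (\<exists>j\<in>J b. a j \<noteq> \<eta> j))
      \<le> (\<Sum>b\<in>B. \<Sum>j\<in>J b. of_bool (a j \<noteq> \<eta> j) :: real)"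
  proof (rule sum_mono)
    fix b assume b: "b \<in> B"
    show "of_bool (\<exists>j\<in>J b. a j \<noteq> \<eta> j) \<le> (\<Sum>j\<in>J b. of_bool (a j \<noteq> \<eta> j) :: real)"
    proof (cases "\<exists>j\<in>J b. a j \<noteq> \<eta> j")
      case True
      then obtain j where "j \<in> J b" "a j \<noteq> \<eta> j" by blast
      then show ?thesis
        using fin[OF b] member_le_sum[of j "J b" "\<lambda>j. of_bool (a j \<noteq> \<eta> j) :: real"] by auto
    qed (auto intro: sum_nonneg)
  qed
  also have "\<dots> = (\<Sum>j\<in>(\<Union>b\<in>B. J b). of_bool (a j \<noteq> \<eta> j))"
    using assms fin by (intro sum.UNION_disjoint[symmetric]) (auto simp: disjoint_family_on_def)
  also have "\<dots> \<le> hamming_loss d a \<eta>"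
    unfolding hamming_loss_def using assms(2) by (intro sum_mono2) auto
  finally show ?thesis .
qed

lemma selector_risk_ge_block_errors:
  assumes sel: "(Q, h) \<in> selectors d M"
    and P: "prob_space P\<^sub>0" "prob_space P\<^sub>1"
    and M: "sets P\<^sub>0 = sets M" "sets P\<^sub>1 = sets M"
    and J: "finite B" "\<And>b. b \<in> B \<Longrightarrow> J b \<subseteq> {1..d}" "disjoint_family_on J B"
  shows "(\<Sum>b\<in>B. block_error d P\<^sub>0 P\<^sub>1 Q h (J b) \<eta>) \<le> selector_risk d P\<^sub>0 P\<^sub>1 (Q, h) \<eta>"
proof -
  define L where "L = observation_law d P\<^sub>0 P\<^sub>1 \<eta>"
  define D where "D = (\<lambda>b. {y \<in> space (L \<Otimes>\<^sub>M Q). \<exists>j\<in>J b. h y j \<noteq> \<eta> j})"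
  have Q: "prob_space Q" using sel by (simp add: selectors_def)
  interpret Q: prob_space Q by (rule Q)
  interpret L: prob_space L
    unfolding L_def by (rule prob_space_observation_law) fact+
  interpret pair_prob_space L Q ..
  have h: "h \<in> L \<Otimes>\<^sub>M Q \<rightarrow>\<^sub>M count_space (binary_vectors d)"
    by (rule selector_measurable[OF sel]) (simp only: L_def sets_observation_law[OF M])
  have D: "D b \<in> sets (L \<Otimes>\<^sub>M Q)" for b
  proof -
    have "D b = h -` {a \<in> binary_vectors d. \<exists>j\<in>J b. a j \<noteq> \<eta> j} \<inter> space (L \<Otimes>\<^sub>M Q)"
      using measurable_space[OF h] by (auto simp: D_def)
    then show ?thesis
      using measurable_sets[OF h] by (metis (no_types, lifting) sets_count_space Pow_iff mem_Collect_eq subsetI)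
  qed
  have int: "integrable (L \<Otimes>\<^sub>M Q) (\<lambda>y. indicator (D b) y :: real)" for b
    using D by (intro integrable_real_indicator) (auto simp: P.emeasure_eq_measure)
  have "(\<Sum>b\<in>B. block_error d P\<^sub>0 P\<^sub>1 Q h (J b) \<eta>) = (\<Sum>b\<in>B. \<integral>y. indicator (D b) y \<partial>(L \<Otimes>\<^sub>M Q))"
    using D by (intro sum.cong) (simp_all add: block_error_def D_def L_def)
  also have "\<dots> = (\<integral>y. (\<Sum>b\<in>B. indicator (D b) y) \<partial>(L \<Otimes>\<^sub>M Q))"
    using int by (intro Bochner_Integration.integral_sum[symmetric]) auto
  also have "\<dots> \<le> (\<integral>y. hamming_loss d (h y) \<eta> \<partial>(L \<Otimes>\<^sub>M Q))"
  proof (rule integral_mono)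
    show "integrable (L \<Otimes>\<^sub>M Q) (\<lambda>y. \<Sum>b\<in>B. indicator (D b) y :: real)"
      using int by (intro Bochner_Integration.integrable_sum) auto
    show "integrable (L \<Otimes>\<^sub>M Q) (\<lambda>y. hamming_loss d (h y) \<eta>)"
      unfolding L_def by (rule integrable_hamming_loss[OF sel P M])
    fix y assume "y \<in> space (L \<Otimes>\<^sub>M Q)"
    then have "(\<Sum>b\<in>B. indicator (D b) y) = (\<Sum>b\<in>B. of_bool (\<exists>j\<in>J b. h y j \<noteq> \<eta> j) :: real)"
      by (intro sum.cong) (auto simp: D_def indicator_def)
    also have "\<dots> \<le> hamming_loss d (h y) \<eta>"
      by (rule hamming_loss_ge_blocks[OF J])
    finally show "(\<Sum>b\<in>B. indicator (D b) y) \<le> hamming_loss d (h y) \<eta>" .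
  qed
  finally show ?thesis by (simp add: selector_risk_def L_def)
qed

text \<open>Serves to condition on the positions \<open>g\<close> chosen in the other blocks and
  then to sum over the position \<open>k\<close> within block \<open>b\<close>, where the
  single-block bound applies.\<close>

lemma sum_PiE_remove:
  fixes G :: "('i \<Rightarrow> 'a) \<Rightarrow> real"
  assumes "b \<in> B"
  shows "(\<Sum>\<kappa>\<in>Pi\<^sub>E B J. G \<kappa>) = (\<Sum>g\<in>Pi\<^sub>E (B - {b}) J. \<Sum>k\<in>J b. G (g(b := k)))"
proof -
  have "Pi\<^sub>E B J = (\<lambda>(k, g). g(b := k)) ` (J b \<times> Pi\<^sub>E (B - {b}) J)"
    using PiE_insert_eq[of b "B - {b}" J] assms by (simp add: insert_absorb)
  then have "(\<Sum>\<kappa>\<in>Pi\<^sub>E B J. G \<kappa>) = (\<Sum>(k, g)\<in>J b \<times> Pi\<^sub>E (B - {b}) J. G (g(b := k)))"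
    using inj_combinator[of b "B - {b}" J]
    by (simp add: sum.reindex case_prod_unfold)
  also have "\<dots> = (\<Sum>k\<in>J b. \<Sum>g\<in>Pi\<^sub>E (B - {b}) J. G (g(b := k)))"
    by (simp add: sum.cartesian_product)
  also have "\<dots> = (\<Sum>g\<in>Pi\<^sub>E (B - {b}) J. \<Sum>k\<in>J b. G (g(b := k)))"
    by (rule sum.swap)
  finally show ?thesis .
qed

text \<open>The supremum dominates the average over the \<open>m ^ card B\<close> signals with one
  nonzero component per block. Exchanging the sums over signals and blocks leaves the single-block
  bound for each block. The average is kept unnormalized, multiplied by \<open>card K\<close>, until
  the end.\<close>

lemma worst_case_risk_lower_bound:
  fixes P\<^sub>0 P\<^sub>1 M :: "real measure" and r :: "real \<Rightarrow> ennreal"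
  assumes P: "prob_space P\<^sub>0" "prob_space P\<^sub>1"
    and M: "sets M = sets borel" "sets P\<^sub>0 = sets M" "sets P\<^sub>1 = sets M"
    and r: "r \<in> borel_measurable P\<^sub>0" "P\<^sub>1 = density P\<^sub>0 r"
    and S: "AE x in P\<^sub>0. x \<in> S" "mono_on S r"
    and sel: "(Q, h) \<in> selectors d M"
    and B: "finite B" "\<And>b. b \<in> B \<Longrightarrow> J b \<subseteq> {1..d}" "disjoint_family_on J B"
    and m: "\<And>b. b \<in> B \<Longrightarrow> card (J b) = m" "0 < m"
  shows "real (card B) * (cdf P\<^sub>1 v * (1 - cdf P\<^sub>0 v ^ (m - 1)))
    \<le> (SUP \<eta>\<in>sparse_vectors d (card B). selector_risk d P\<^sub>0 P\<^sub>1 (Q, h) \<eta>)"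
proof -
  define c where "c = cdf P\<^sub>1 v * (1 - cdf P\<^sub>0 v ^ (m - 1))"
  define K where "K = Pi\<^sub>E B J"
  define \<eta> where "\<eta> = (\<lambda>\<kappa>. indicator_vector d (\<kappa> ` B))"
  let ?sup = "SUP \<eta>\<in>sparse_vectors d (card B). selector_risk d P\<^sub>0 P\<^sub>1 (Q, h) \<eta>"
  have cardK: "card K = m ^ card B"
    unfolding K_def using B(1) m by (simp add: card_PiE)
  have sup: "selector_risk d P\<^sub>0 P\<^sub>1 (Q, h) (\<eta> \<kappa>) \<le> ?sup" if "\<kappa> \<in> K" for \<kappa>
  proof (rule cSUP_upper)
    \<comment> \<open>Positions chosen from disjoint blocks are distinct, so
      \<open>\<eta> \<kappa>\<close> has exactly \<open>card B\<close> nonzero components.\<close>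
    have "inj_on \<kappa> B"
    proof (rule inj_onI)
      fix a b assume ab: "a \<in> B" "b \<in> B" "\<kappa> a = \<kappa> b"
      then have "\<kappa> a \<in> J a \<inter> J b" using that by (auto simp: K_def PiE_def Pi_iff)
      then show "a = b" using B(3) ab by (auto simp: disjoint_family_on_def)
    qed
    moreover have "\<kappa> ` B \<subseteq> {1..d}" using that B(2) by (fastforce simp: K_def PiE_def Pi_iff)
    ultimately show "\<eta> \<kappa> \<in> sparse_vectors d (card B)"
      using indicator_vector_sparse[of "\<kappa> ` B" d] by (simp add: \<eta>_def card_image)
  qed (simp add: finite_sparse_vectors bdd_above_finite)
  have block: "real (card K) * c \<le> (\<Sum>\<kappa>\<in>K. block_error d P\<^sub>0 P\<^sub>1 Q h (J b) (\<eta> \<kappa>))"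
    if b: "b \<in> B" for b
  proof -
    \<comment> \<open>Each choice \<open>g\<close> outside block \<open>b\<close> extends to exactly
      \<open>m\<close> configurations.\<close>
    have "real (card K) * c = (\<Sum>g\<in>Pi\<^sub>E (B - {b}) J. real m * c)"
    proof -
      have "card (Pi\<^sub>E (B - {b}) J) = m ^ (card B - 1)"
        using B(1) m b by (simp add: card_PiE)
      moreover have "m * m ^ (card B - 1) = m ^ card B"
        using b B(1) by (metis Suc_diff_1 card_gt_0_iff empty_iff power_Suc)
      ultimately show ?thesis
        by (simp add: cardK flip: of_nat_mult of_nat_power) (metis mult.assoc mult.commute of_nat_mult)
    qed
    also have "\<dots> \<le> (\<Sum>g\<in>Pi\<^sub>E (B - {b}) J. \<Sum>k\<in>J b. block_error d P\<^sub>0 P\<^sub>1 Q h (J b) (\<eta> (g(b := k))))"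
    proof (rule sum_mono)
      fix g assume g: "g \<in> Pi\<^sub>E (B - {b}) J"
      \<comment> \<open>The signal with block \<open>b\<close> left empty; disjointness of the
        blocks gives the vanishing on \<open>J b\<close> that the single-block bound
        requires.\<close>
      define \<zeta> where "\<zeta> = indicator_vector d (g ` (B - {b}))"
      have \<zeta>: "\<eta> (g(b := k)) = \<zeta>(k := 1)" if "k \<in> J b" for k
      proof -
        have "(g(b := k)) ` B = insert k (g ` (B - {b}))"
          using b by auto
        then show ?thesis
          using indicator_vector_insert[of k d] B(2)[OF b] that by (auto simp: \<eta>_def \<zeta>_def)
      qed
      have "\<zeta> j = 0" if "j \<in> J b" for j
      proof -
        have "j \<notin> g ` (B - {b})"
        proof
          assume "j \<in> g ` (B - {b})"
          then obtain a where "a \<in> B" "a \<noteq> b" "j = g a" by blast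
          moreover from this have "g a \<in> J a" using g by (auto simp: PiE_def Pi_iff)
          ultimately show False using B(3) b that by (auto simp: disjoint_family_on_def)
        qed
        moreover have "j \<in> {1..d}" using B(2)[OF b] that by blast
        ultimately show ?thesis by (simp add: \<zeta>_def indicator_vector_apply)
      qed
      from block_error_lower_bound[OF P M r S sel B(2)[OF b], where v = v and \<zeta> = \<zeta>, OF this]
      show "real m * c \<le> (\<Sum>k\<in>J b. block_error d P\<^sub>0 P\<^sub>1 Q h (J b) (\<eta> (g(b := k))))"
        by (simp add: \<zeta> m b c_def block_error_def)
    qed
    also have "\<dots> = (\<Sum>\<kappa>\<in>K. block_error d P\<^sub>0 P\<^sub>1 Q h (J b) (\<eta> \<kappa>))"
      unfolding K_def by (rule sum_PiE_remove[OF b, symmetric])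
    finally show ?thesis .
  qed
  have "real (card K) * (real (card B) * c) = (\<Sum>b\<in>B. real (card K) * c)"
    by simp
  also have "\<dots> \<le> (\<Sum>b\<in>B. \<Sum>\<kappa>\<in>K. block_error d P\<^sub>0 P\<^sub>1 Q h (J b) (\<eta> \<kappa>))"
    by (rule sum_mono) (rule block)
  also have "\<dots> = (\<Sum>\<kappa>\<in>K. \<Sum>b\<in>B. block_error d P\<^sub>0 P\<^sub>1 Q h (J b) (\<eta> \<kappa>))"
    by (rule sum.swap)
  also have "\<dots> \<le> (\<Sum>\<kappa>\<in>K. ?sup)"
    using selector_risk_ge_block_errors[OF sel P M(2,3) B] sup
    by (intro sum_mono) (rule order_trans)
  finally have "real (card K) * (real (card B) * c) \<le> real (card K) * ?sup"
    by simp
  moreover have "0 < card K" using cardK m by simp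
  ultimately show ?thesis by (simp add: c_def)
qed

section \<open>The likelihood ratio and the choice of blocks\<close>

text \<open>The identity \<open>f\<^sub>1 x = f\<^sub>0 x * (f\<^sub>1 x / f\<^sub>0 x)\<close>
  holds everywhere: at a zero of \<open>f\<^sub>0\<close> both sides are 0.\<close>

lemma density_ratio:
  fixes f\<^sub>0 f\<^sub>1 :: "'a \<Rightarrow> real"
  assumes [measurable]: "f\<^sub>0 \<in> borel_measurable M" "f\<^sub>1 \<in> borel_measurable M"
    and pos: "\<And>x. 0 \<le> f\<^sub>0 x" "\<And>x. 0 \<le> f\<^sub>1 x"
    and supp: "\<And>x. f\<^sub>0 x = 0 \<Longrightarrow> f\<^sub>1 x = 0"
  shows "density M (\<lambda>x. ennreal (f\<^sub>1 x))
    = density (density M (\<lambda>x. ennreal (f\<^sub>0 x))) (\<lambda>x. ennreal (f\<^sub>1 x / f\<^sub>0 x))"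
proof -
  have "ennreal (f\<^sub>1 x) = ennreal (f\<^sub>0 x) * ennreal (f\<^sub>1 x / f\<^sub>0 x)" for x
    using pos[of x] supp[of x] by (cases "f\<^sub>0 x = 0") (simp_all flip: ennreal_mult)
  then show ?thesis
    by (simp add: density_density_eq)
qed

theorem proposition2:
  fixes d s :: nat
    and M P\<^sub>0 P\<^sub>1 :: "real measure"
    and f\<^sub>0 f\<^sub>1 :: "real \<Rightarrow> real"
    and t :: real
  assumes "d > 2" and "1 \<le> s" and "real s < real d / 2"
    and "sets M = sets borel"
    and "f\<^sub>0 \<in> borel_measurable M" and "\<And>x. 0 \<le> f\<^sub>0 x"
    and "f\<^sub>1 \<in> borel_measurable M" and "\<And>x. 0 \<le> f\<^sub>1 x"
    and "P\<^sub>0 = density M (\<lambda>x. ennreal (f\<^sub>0 x))" and "prob_space P\<^sub>0"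
    and "P\<^sub>1 = density M (\<lambda>x. ennreal (f\<^sub>1 x))" and "prob_space P\<^sub>1"
    and "P\<^sub>0 \<noteq> P\<^sub>1"
    and "mlr_property f\<^sub>0 f\<^sub>1"
    and "t = 1 - 1 / (real_of_int \<lfloor>real d / real s\<rfloor> - 1)"
    and "0 < t" and "t < 1" and "\<exists>v. is_quantile P\<^sub>0 t v"
  shows "(INF sel \<in> (selectors d M :: ('z measure \<times> ((nat \<Rightarrow> real) \<times> 'z \<Rightarrow> (nat \<Rightarrow> nat))) set).
            SUP \<eta> \<in> sparse_vectors d s. selector_risk d P\<^sub>0 P\<^sub>1 sel \<eta>)
         \<ge> (1 - exp (- 1)) * real s * cdf P\<^sub>1 (quantile P\<^sub>0 t)"
proof (rule cINF_greatest)
  show "(selectors d M :: ('z measure \<times> _) set) \<noteq> {}"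
    by (rule selectors_nonempty)
next
  fix sel :: "'z measure \<times> ((nat \<Rightarrow> real) \<times> 'z \<Rightarrow> (nat \<Rightarrow> nat))"
  assume "sel \<in> selectors d M"
  then obtain Q h where sel: "sel = (Q, h)" "(Q, h) \<in> selectors d M" by (cases sel) auto
  define m where "m = d div s"
  define v where "v = quantile P\<^sub>0 t"
  \<comment> \<open>Blocks are numbered from 0 while coordinates start at 1, hence the offset. As
    \<open>m\<close> is \<open>d div s\<close>, \<open>s\<close> such blocks fit into
    \<open>{1..d}\<close>.\<close>
  define J where "J = (\<lambda>b. {b * m + 1..b * m + m})"
  \<comment> \<open>The assumed existence of the minimum guarantees that the \<open>LEAST\<close> in
    \<open>quantile\<close> is attained, so the value \<open>t\<close> is hit exactly.\<close>
  have v: "cdf P\<^sub>0 v = t"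
    using assms(18) quantile_eqI unfolding v_def is_quantile_def by metis
  have floor: "\<lfloor>real d / real s\<rfloor> = int m"
    unfolding m_def by (rule floor_divide_of_nat_eq)
  have "0 < m" using assms(1-3) by (simp add: m_def div_greater_zero_iff)
  then have t: "t = 1 - 1 / real (m - 1)"
    using assms(15) floor by (simp add: of_nat_diff)
  \<comment> \<open>For \<open>m - 1 = 0\<close> the convention \<open>1 / 0 = 0\<close> would yield
    \<open>t = 1\<close>, against \<open>t < 1\<close>.\<close>
  have "m - 1 > 0" using assms(17) t by (cases "m - 1 = 0") auto
  \<comment> \<open>\<open>P\<^sub>0\<close> gives no mass to the zeros of its own density, so the
    support, where the ratio is increasing, can play the part of \<open>S\<close>.\<close>
  have S: "AE x in P\<^sub>0. x \<in> {x. f\<^sub>0 x \<noteq> 0}"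
    unfolding assms(9) using assms(5) by (subst AE_density) auto
  have supp: "{x. f\<^sub>0 x \<noteq> 0} = {x. f\<^sub>1 x \<noteq> 0}"
    and incr: "strict_mono_on {x. f\<^sub>0 x \<noteq> 0} (\<lambda>x. f\<^sub>1 x / f\<^sub>0 x)"
    using assms(14) by (auto simp: mlr_property_def)
  have P1: "P\<^sub>1 = density P\<^sub>0 (\<lambda>x. ennreal (f\<^sub>1 x / f\<^sub>0 x))"
    unfolding assms(9,11) using assms(5-8) supp by (intro density_ratio) auto
  have mono: "mono_on {x. f\<^sub>0 x \<noteq> 0} (\<lambda>x. ennreal (f\<^sub>1 x / f\<^sub>0 x))"
    using strict_mono_on_imp_mono_on[OF incr] by (auto simp: monotone_on_def intro: ennreal_leI)
  have J: "J b \<subseteq> {1..d}" if "b \<in> {..<s}" for b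
  proof -
    have "b * m + m \<le> s * m" using mult_le_mono1[of "Suc b" s m] that by simp
    also have "\<dots> \<le> d" by (simp add: m_def)
    finally show ?thesis by (auto simp: J_def)
  qed
  have disj: "disjoint_family_on J {..<s}"
  proof -
    have "J a \<inter> J b = {}" if "a < b" for a b
      using mult_le_mono1[of "Suc a" b m] that by (auto simp: J_def)
    then have "J a \<inter> J b = {}" if "a \<noteq> b" for a b
      using that by (metis Int_commute linorder_neqE_nat)
    then show ?thesis by (auto simp: disjoint_family_on_def)
  qed
  \<comment> \<open>The exponent is the number of noise positions in a block. The level
    \<open>t\<close> is matched to it, so the probability that all of them stay below the threshold
    is at most \<open>exp (- 1)\<close>.\<close>
  have "(1 - 1 / real (m - 1)) ^ (m - 1) \<le> exp (- 1)"
    using \<open>m - 1 > 0\<close> by (intro exp_ge_one_minus_x_over_n_power_n) auto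
  then have "(1 - exp (- 1)) * real s * cdf P\<^sub>1 v \<le> real s * (cdf P\<^sub>1 v * (1 - cdf P\<^sub>0 v ^ (m - 1)))"
    unfolding v t
    by (simp add: mult.commute mult.left_commute mult_left_mono cdf_def)
  also have "\<dots> \<le> (SUP \<eta>\<in>sparse_vectors d s. selector_risk d P\<^sub>0 P\<^sub>1 sel \<eta>)"
    using worst_case_risk_lower_bound[OF assms(10,12,4) _ _ _ P1 S mono sel(2) _ J disj, of m v]
      \<open>0 < m\<close> assms(5,7) by (simp add: J_def sel(1) assms(9,11))
  finally show "(1 - exp (- 1)) * real s * cdf P\<^sub>1 (quantile P\<^sub>0 t)
      \<le> (SUP \<eta>\<in>sparse_vectors d s. selector_risk d P\<^sub>0 P\<^sub>1 sel \<eta>)"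
    by (simp add: v_def)
qed

end
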